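(* Let $N\ge 1$ be an integer, let $l>0$ and $\varepsilon_A,\varepsilon_B\in[0,1]$. Consider any hidden-variable (HV) model for settings $x,y\in\{0,1\}$ and outcomes $a=(a_1,\dots,a_N)\in\{0,1\}^N$, $b=(b_1,\dots,b_N)\in\{0,1\}^N$ that is $l$-measurement dependent, $(\varepsilon_A,\varepsilon_B)$-parameter dependent, and satisfies outcome independence. Let $p(a,b\mid x,y)$ be the correlation it produces, and suppose that (i) $p(a,b\mid 0,1)=0$ for all $a,b$ such that $(a_i,b_i)=(0,1)$ for some $i\in\{1,\dots,N\}$; (ii) $p(a,b\mid 1,0)=0$ for all $a,b$ such that $(a_i,b_i)=(1,0)$ for some $i$; (iii) $p(a,b\mid 1,1)=0$ for all $a,b$ such that $(a_i,b_i)=(0,0)$ for some $i$. Then $$p_H^N:=\sum_{\substack{a,b\in\{0,1\}^N\\ \exists i:\ (a_i,b_i)=(0,0)}}p(a,b\mid 0,0)\ \le\ \varepsilon_A+\varepsilon_B-\varepsilon_A\varepsilon_B .$$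
   Context: HV model: a probability space $(\Lambda,\mu)$ of hidden variables $\lambda$; for each $\lambda$ a probability distribution $p(x,y\mid\lambda)$ on pairs of settings; and for each $\lambda,x,y$ a probability distribution $p(a,b\mid\lambda,x,y)$ on pairs of outcomes (all measurable in $\lambda$). The setting distribution is $p(x,y)=\int p(x,y\mid\lambda)\,d\mu(\lambda)$, and (by Bayes, $p(\lambda\mid x,y)=p(\lambda)p(x,y\mid\lambda)/p(x,y)$) the correlation produced is $$p(a,b\mid x,y)=\frac{1}{p(x,y)}\int p(x,y\mid\lambda)\,p(a,b\mid\lambda,x,y)\,d\mu(\lambda).$$ Marginals: $p(a\mid\lambda,x,y)=\sum_b p(a,b\mid\lambda,x,y)$ and $p(b\mid\lambda,x,y)=\sum_a p(a,b\mid\lambda,x,y)$. $l$-measurement dependent ($l$-MD): $p(x,y\mid\lambda)\ge l$ for all $x,y,\lambda$. Outcome independence (OI): $p(a,b\mid\lambda,x,y)=p(a\mid\lambda,x,y)\,p(b\mid\lambda,x,y)$ for all $a,b,x,y,\lambda$. $(\varepsilon_A,\varepsilon_B)$-parameter dependent (PD): for all $\lambda$, all $x,y,y'$: $\frac12\sum_a|p(a\mid\lambda,x,y)-p(a\mid\lambda,x,y')|\le\varepsilon_A$; and for all $\lambda$, all $y,x,x'$: $\frac12\sum_b|p(b\mid\lambda,x,y)-p(b\mid\lambda,x',y)|\le\varepsilon_B$. *)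

theory Defs
  imports "HOL-Probability.Probability"
begin

text \<open>
  A hidden-variable model has setting alphabets \<open>X\<close>, \<open>Y\<close>, outcome alphabets \<open>A\<close>, \<open>B\<close>,
  \<open>pS lam x y\<close> for p(x,y|lam), and \<open>pO lam x y a b\<close> for p(a,b|lam,x,y). Values of \<open>pS\<close> and
  \<open>pO\<close> outside the alphabets or outside \<open>space M\<close> are irrelevant.
\<close>

definition joint_distribution :: "'a set \<Rightarrow> 'b set \<Rightarrow> ('a \<Rightarrow> 'b \<Rightarrow> real) \<Rightarrow> bool" where
  "joint_distribution A B p \<longleftrightarrow>
     finite A \<and> finite B \<and> (\<forall>a\<in>A. \<forall>b\<in>B. 0 \<le> p a b) \<and> (\<Sum>a\<in>A. \<Sum>b\<in>B. p a b) = 1"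

definition hv_model ::
  "'l measure \<Rightarrow> 'x set \<Rightarrow> 'y set \<Rightarrow> 'a set \<Rightarrow> 'b set \<Rightarrow>
   ('l \<Rightarrow> 'x \<Rightarrow> 'y \<Rightarrow> real) \<Rightarrow> ('l \<Rightarrow> 'x \<Rightarrow> 'y \<Rightarrow> 'a \<Rightarrow> 'b \<Rightarrow> real) \<Rightarrow> bool" where
  "hv_model M X Y A B pS pO \<longleftrightarrow>
     prob_space M \<and>
     (\<forall>lam\<in>space M. joint_distribution X Y (pS lam)) \<and>
     (\<forall>lam\<in>space M. \<forall>x\<in>X. \<forall>y\<in>Y. joint_distribution A B (pO lam x y)) \<and>
     (\<forall>x\<in>X. \<forall>y\<in>Y. (\<lambda>lam. pS lam x y) \<in> borel_measurable M) \<and>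
     (\<forall>x\<in>X. \<forall>y\<in>Y. \<forall>a\<in>A. \<forall>b\<in>B. (\<lambda>lam. pO lam x y a b) \<in> borel_measurable M)"

definition setting_prob ::
  "'l measure \<Rightarrow> ('l \<Rightarrow> 'x \<Rightarrow> 'y \<Rightarrow> real) \<Rightarrow> 'x \<Rightarrow> 'y \<Rightarrow> real" where
  "setting_prob M pS x y = (\<integral>lam. pS lam x y \<partial>M)"

definition correlation ::
  "'l measure \<Rightarrow> ('l \<Rightarrow> 'x \<Rightarrow> 'y \<Rightarrow> real) \<Rightarrow> ('l \<Rightarrow> 'x \<Rightarrow> 'y \<Rightarrow> 'a \<Rightarrow> 'b \<Rightarrow> real) \<Rightarrow>
   'x \<Rightarrow> 'y \<Rightarrow> 'a \<Rightarrow> 'b \<Rightarrow> real" where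
  "correlation M pS pO x y a b =
     (1 / setting_prob M pS x y) * (\<integral>lam. pS lam x y * pO lam x y a b \<partial>M)"

definition marginal_A ::
  "'b set \<Rightarrow> ('l \<Rightarrow> 'x \<Rightarrow> 'y \<Rightarrow> 'a \<Rightarrow> 'b \<Rightarrow> real) \<Rightarrow> 'l \<Rightarrow> 'x \<Rightarrow> 'y \<Rightarrow> 'a \<Rightarrow> real" where
  "marginal_A B pO lam x y a = (\<Sum>b\<in>B. pO lam x y a b)"

definition marginal_B ::
  "'a set \<Rightarrow> ('l \<Rightarrow> 'x \<Rightarrow> 'y \<Rightarrow> 'a \<Rightarrow> 'b \<Rightarrow> real) \<Rightarrow> 'l \<Rightarrow> 'x \<Rightarrow> 'y \<Rightarrow> 'b \<Rightarrow> real" where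
  "marginal_B A pO lam x y b = (\<Sum>a\<in>A. pO lam x y a b)"

definition measurement_dependent ::
  "real \<Rightarrow> 'l measure \<Rightarrow> 'x set \<Rightarrow> 'y set \<Rightarrow> ('l \<Rightarrow> 'x \<Rightarrow> 'y \<Rightarrow> real) \<Rightarrow> bool" where
  "measurement_dependent l M X Y pS \<longleftrightarrow> (\<forall>lam\<in>space M. \<forall>x\<in>X. \<forall>y\<in>Y. l \<le> pS lam x y)"

definition outcome_independent ::
  "'l measure \<Rightarrow> 'x set \<Rightarrow> 'y set \<Rightarrow> 'a set \<Rightarrow> 'b set \<Rightarrow>
   ('l \<Rightarrow> 'x \<Rightarrow> 'y \<Rightarrow> 'a \<Rightarrow> 'b \<Rightarrow> real) \<Rightarrow> bool" where
  "outcome_independent M X Y A B pO \<longleftrightarrow>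
     (\<forall>lam\<in>space M. \<forall>x\<in>X. \<forall>y\<in>Y. \<forall>a\<in>A. \<forall>b\<in>B.
        pO lam x y a b = marginal_A B pO lam x y a * marginal_B A pO lam x y b)"

definition parameter_dependent ::
  "real \<Rightarrow> real \<Rightarrow> 'l measure \<Rightarrow> 'x set \<Rightarrow> 'y set \<Rightarrow> 'a set \<Rightarrow> 'b set \<Rightarrow>
   ('l \<Rightarrow> 'x \<Rightarrow> 'y \<Rightarrow> 'a \<Rightarrow> 'b \<Rightarrow> real) \<Rightarrow> bool" where
  "parameter_dependent epsA epsB M X Y A B pO \<longleftrightarrow>
     (\<forall>lam\<in>space M. \<forall>x\<in>X. \<forall>y\<in>Y. \<forall>y'\<in>Y.
        1/2 * (\<Sum>a\<in>A. \<bar>marginal_A B pO lam x y a - marginal_A B pO lam x y' a\<bar>) \<le> epsA) \<and>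
     (\<forall>lam\<in>space M. \<forall>y\<in>Y. \<forall>x\<in>X. \<forall>x'\<in>X.
        1/2 * (\<Sum>b\<in>B. \<bar>marginal_B A pO lam x y b - marginal_B A pO lam x' y b\<bar>) \<le> epsB)"

definition bit_strings :: "nat \<Rightarrow> (nat \<Rightarrow> nat) set" where
  "bit_strings N = {1..N} \<rightarrow>\<^sub>E {0, 1}"

end

theory Submission
  imports Defs
begin

text \<open>
  Fix a hidden variable for which the three families of zero probabilities hold pointwise (almost
  every one does). By outcome independence, (i) gives for every index \<open>i\<close> that \<open>a\<^sub>i = 1\<close> almost
  surely or \<open>b\<^sub>i = 0\<close> almost surely under the settings (0,1); let \<open>S\<close> be the set of indices of the
  first kind. If a parameter equals 1, then the bound is 1; otherwise distributions that differ only
  in the remote setting have intersecting supports. For \<open>i \<notin> S\<close> this carries \<open>b\<^sub>i = 0\<close> from (0,1) to (1,1), whence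
  \<open>a\<^sub>i = 1\<close> surely there by (iii), and then \<open>a\<^sub>i = 1\<close> from (1,1) to (1,0), whence \<open>b\<^sub>i = 1\<close> surely
  there by (ii). Under the settings (0,0), Alice has \<open>a\<^sub>i = 1\<close> on all of \<open>S\<close> with probability at least
  \<open>1 - \<epsilon>\<^sub>A\<close>, and independently Bob has \<open>b\<^sub>i = 1\<close> off \<open>S\<close> with probability at least \<open>1 - \<epsilon>\<^sub>B\<close>; in that
  case no index has \<open>(a\<^sub>i, b\<^sub>i) = (0, 0)\<close>.
\<close>

section \<open>Total variation, and the bound at a single hidden variable\<close>

definition prob_vec :: "'a set \<Rightarrow> ('a \<Rightarrow> real) \<Rightarrow> bool" where
  "prob_vec A f \<longleftrightarrow> finite A \<and> (\<forall>a\<in>A. 0 \<le> f a) \<and> sum f A = 1"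

definition total_variation :: "'a set \<Rightarrow> ('a \<Rightarrow> real) \<Rightarrow> ('a \<Rightarrow> real) \<Rightarrow> real" where
  "total_variation A f g = 1/2 * (\<Sum>a\<in>A. \<bar>f a - g a\<bar>)"

text \<open>Since \<open>g - f\<close> sums to zero over \<open>A\<close>, the excess of
  \<open>g\<close> on \<open>S\<close> equals its deficit off \<open>S\<close>. Each is at most the
  sum of \<open>\<bar>f a - g a\<bar>\<close> over its own part, so twice the excess is at most the
  full sum.\<close>

lemma sum_diff_le_total_variation:
  assumes "finite A" "S \<subseteq> A" "sum f A = sum g A"
  shows "sum g S - sum f S \<le> total_variation A f g"
proof -
  let ?d = "\<lambda>a. g a - f a"
  have split: "sum h A = sum h S + sum h (A - S)" for h :: "'a \<Rightarrow> real"
    using sum.subset_diff[OF assms(2,1), of h] by simp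
  have "sum ?d S + sum ?d (A - S) = 0"
    using split[of ?d] assms(3) by (simp add: sum_subtractf)
  moreover have "sum ?d S \<le> (\<Sum>a\<in>S. \<bar>f a - g a\<bar>)" by (intro sum_mono) simp
  moreover have "- sum ?d (A - S) \<le> (\<Sum>a\<in>A - S. \<bar>f a - g a\<bar>)"
    unfolding sum_negf[symmetric] by (intro sum_mono) simp
  ultimately show ?thesis
    using split[of "\<lambda>a. \<bar>f a - g a\<bar>"] by (simp add: total_variation_def sum_subtractf[of g f S])
qed

lemma prob_ge_of_almost_sure:
  assumes "prob_vec A f" "prob_vec A g" "total_variation A f g \<le> e"
    and "\<And>a. a \<in> A \<Longrightarrow> 0 < g a \<Longrightarrow> E a"
  shows "1 - e \<le> sum f {a\<in>A. E a}"
proof -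
  have "sum g {a\<in>A. E a} = sum g A"
    using assms(2,4) by (intro sum.mono_neutral_left) (force simp: prob_vec_def)+
  then show ?thesis
    using sum_diff_le_total_variation[of A "{a\<in>A. E a}" f g] assms(1-3)
    by (auto simp: prob_vec_def)
qed

text \<open>The support of \<open>g\<close> is an almost sure event for \<open>g\<close>, so
  \<open>f\<close> gives it mass at least \<open>1 - e > 0\<close>.\<close>

lemma supports_intersect:
  assumes "prob_vec A f" "prob_vec A g" "total_variation A f g \<le> e" "e < 1"
  obtains a where "a \<in> A" "0 < f a" "0 < g a"
proof -
  have "0 < sum f {a\<in>A. 0 < g a}"
    using prob_ge_of_almost_sure[OF assms(1-3), of "\<lambda>a. 0 < g a"] assms(4) by simp
  then obtain a where "a \<in> A" "0 < g a" "0 < f a"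
    by (metis (mono_tags, lifting) mem_Collect_eq not_less sum_nonpos)
  then show thesis using that by blast
qed

text \<open>This is the argument at one hidden variable: \<open>P x y\<close> and
  \<open>Q x y\<close> stand for the two marginals, and outcome independence has already turned the
  joint distribution into their product.\<close>

lemma hardy_bound_product:
  fixes P Q :: "nat \<Rightarrow> nat \<Rightarrow> ('i \<Rightarrow> nat) \<Rightarrow> real"
  assumes P: "\<And>x y. x \<in> {0,1} \<Longrightarrow> y \<in> {0,1} \<Longrightarrow> prob_vec A (P x y)"
    and Q: "\<And>x y. x \<in> {0,1} \<Longrightarrow> y \<in> {0,1} \<Longrightarrow> prob_vec B (Q x y)"
    and e: "0 \<le> eA" "eA \<le> 1" "0 \<le> eB" "eB \<le> 1"
    and PD_A: "\<And>x y y'. x \<in> {0,1} \<Longrightarrow> y \<in> {0,1} \<Longrightarrow> y' \<in> {0,1} \<Longrightarrow>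
                 total_variation A (P x y) (P x y') \<le> eA"
    and PD_B: "\<And>x x' y. x \<in> {0,1} \<Longrightarrow> x' \<in> {0,1} \<Longrightarrow> y \<in> {0,1} \<Longrightarrow>
                 total_variation B (Q x y) (Q x' y) \<le> eB"
    and bits: "\<And>a i. a \<in> A \<union> B \<Longrightarrow> i \<in> I \<Longrightarrow> a i = 0 \<or> a i = 1"
    and z01: "\<And>a b i. a \<in> A \<Longrightarrow> b \<in> B \<Longrightarrow> i \<in> I \<Longrightarrow> a i = 0 \<Longrightarrow> b i = 1 \<Longrightarrow>
                 P 0 1 a * Q 0 1 b = 0"
    and z10: "\<And>a b i. a \<in> A \<Longrightarrow> b \<in> B \<Longrightarrow> i \<in> I \<Longrightarrow> a i = 1 \<Longrightarrow> b i = 0 \<Longrightarrow>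
                 P 1 0 a * Q 1 0 b = 0"
    and z11: "\<And>a b i. a \<in> A \<Longrightarrow> b \<in> B \<Longrightarrow> i \<in> I \<Longrightarrow> a i = 0 \<Longrightarrow> b i = 0 \<Longrightarrow>
                 P 1 1 a * Q 1 1 b = 0"
  shows "(\<Sum>(a, b)\<in>{(a, b). a \<in> A \<and> b \<in> B \<and> (\<exists>i\<in>I. (a i, b i) = (0, 0))}. P 0 0 a * Q 0 0 b)
           \<le> eA + eB - eA * eB"
    (is "sum ?f ?H \<le> _")
proof -
  have fin: "finite A" "finite B" using P[of 0 0] Q[of 0 0] by (auto simp: prob_vec_def)
  have nonneg: "0 \<le> ?f z" if "z \<in> A \<times> B" for z
    using that P[of 0 0] Q[of 0 0] by (auto simp: prob_vec_def)
  have total: "sum ?f (A \<times> B) = 1"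
    using P[of 0 0] Q[of 0 0]
    by (simp add: prob_vec_def sum.cartesian_product[symmetric] sum_product[symmetric])
  have H: "?H \<subseteq> A \<times> B" by auto
  show ?thesis
  proof (cases "eA < 1 \<and> eB < 1")
    case False
    \<comment> \<open>The bound is \<open>1 - (1 - eA) * (1 - eB)\<close>, so it reaches 1 as soon
      as one parameter does.\<close>
    with e have "eA + eB - eA * eB = 1" by auto
    moreover have "sum ?f ?H \<le> sum ?f (A \<times> B)"
      using fin H nonneg by (intro sum_mono2) auto
    ultimately show ?thesis using total by simp
  next
    case True
    \<comment> \<open>\<open>S\<close> is read off from the settings (0,1) alone, so one split of
      the indices serves both parties. Alice comes to (0,0) from (0,1), Bob from (1,0); each time
      only the remote setting changes.\<close>
    define S where "S = {i\<in>I. \<forall>a\<in>A. 0 < P 0 1 a \<longrightarrow> a i = 1}"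
    have off_S: "b i = 1" if i: "i \<in> I" "i \<notin> S" and b: "b \<in> B" "0 < Q 1 0 b" for i b
    proof -
      obtain a1 where a1: "a1 \<in> A" "0 < P 0 1 a1" "a1 i = 0"
        using i bits unfolding S_def by blast
      \<comment> \<open>One common point of the two supports suffices: with \<open>a1\<close>, (i)
        forces its bit to be 0, and its positive weight at (1,1) lets (iii) exclude zeros on Alice's
        side there. The point \<open>a2\<close> links (1,1) to (1,0) in the same way.\<close>
      obtain b1 where b1: "b1 \<in> B" "0 < Q 0 1 b1" "0 < Q 1 1 b1"
        using supports_intersect[OF Q Q PD_B] True by (metis insertCI)
      have "b1 i = 0" using z01[of a1 b1 i] a1 b1 i bits[of b1 i] by auto
      obtain a2 where a2: "a2 \<in> A" "0 < P 1 1 a2" "0 < P 1 0 a2"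
        using supports_intersect[OF P P PD_A] True by (metis insertCI)
      have "a2 i = 1" using z11[of a2 b1 i] \<open>b1 i = 0\<close> a2 b1 i bits[of a2 i] by auto
      then show "b i = 1" using z10[of a2 b i] a2 b i bits[of b i] by auto
    qed
    let ?SA = "{a\<in>A. \<forall>i\<in>S. a i = 1}"
    let ?SB = "{b\<in>B. \<forall>i\<in>I - S. b i = 1}"
    have "1 - eA \<le> sum (P 0 0) ?SA"
      by (rule prob_ge_of_almost_sure[where g = "P 0 1"]) (auto intro!: P PD_A simp: S_def)
    moreover have "1 - eB \<le> sum (Q 0 0) ?SB"
      by (rule prob_ge_of_almost_sure[where g = "Q 1 0"]) (use off_S in \<open>auto intro!: Q PD_B\<close>)
    ultimately have "(1 - eA) * (1 - eB) \<le> sum (P 0 0) ?SA * sum (Q 0 0) ?SB"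
      using e by (intro mult_mono) auto
    also have "\<dots> = sum ?f (?SA \<times> ?SB)"
      by (simp add: sum_product sum.cartesian_product)
    also have "\<dots> \<le> sum ?f (A \<times> B - ?H)"
    proof (rule sum_mono2)
      show "?SA \<times> ?SB \<subseteq> A \<times> B - ?H"
      proof -
        have "(a i, b i) \<noteq> (0, 0)" if "a \<in> ?SA" "b \<in> ?SB" "i \<in> I" for a b i
          using that by (cases "i \<in> S") auto
        then show ?thesis by blast
      qed
    qed (use fin nonneg in auto)
    also have "\<dots> = 1 - sum ?f ?H"
      using total fin H by (simp add: sum_diff)
    finally show ?thesis by (simp add: algebra_simps)
  qed
qed

section \<open>Integration over the hidden variable\<close>

lemma joint_distribution_le_1:
  assumes "joint_distribution A B p" "a \<in> A" "b \<in> B"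
  shows "p a b \<le> 1"
proof -
  have "p a b \<le> (\<Sum>b\<in>B. p a b)"
    using assms by (intro member_le_sum) (auto simp: joint_distribution_def)
  also have "\<dots> \<le> (\<Sum>a\<in>A. \<Sum>b\<in>B. p a b)"
    using assms by (intro member_le_sum[where f = "\<lambda>a. \<Sum>b\<in>B. p a b"])
      (auto simp: joint_distribution_def intro!: sum_nonneg)
  finally show ?thesis using assms by (simp add: joint_distribution_def)
qed

lemma prob_vec_marginals:
  assumes "joint_distribution A B (pO lam x y)"
  shows "prob_vec A (marginal_A B pO lam x y)" "prob_vec B (marginal_B A pO lam x y)"
proof -
  show "prob_vec A (marginal_A B pO lam x y)"
    using assms by (auto simp: prob_vec_def joint_distribution_def marginal_A_def intro!: sum_nonneg)
  have "(\<Sum>b\<in>B. \<Sum>a\<in>A. pO lam x y a b) = (\<Sum>a\<in>A. \<Sum>b\<in>B. pO lam x y a b)"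
    by (rule sum.swap)
  then show "prob_vec B (marginal_B A pO lam x y)"
    using assms by (auto simp: prob_vec_def joint_distribution_def marginal_B_def intro!: sum_nonneg)
qed

context
  fixes M :: "'l measure" and X :: "'x set" and Y :: "'y set" and A :: "'a set" and B :: "'b set"
    and pS pO l
  assumes hv: "hv_model M X Y A B pS pO"
    and md: "measurement_dependent l M X Y pS" and l: "0 < l"
begin

lemma integrable_setting:
  assumes "x \<in> X" "y \<in> Y"
  shows "integrable M (\<lambda>lam. pS lam x y)"
proof -
  interpret prob_space M using hv by (simp add: hv_model_def)
  have "\<bar>pS lam x y\<bar> \<le> 1" if "lam \<in> space M" for lam
    using hv that assms joint_distribution_le_1[of X Y "pS lam" x y]
    by (auto simp: hv_model_def joint_distribution_def)
  then show ?thesis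
    using hv assms by (intro integrable_const_bound[where B = 1]) (auto simp: hv_model_def)
qed

lemma integrable_setting_outcome:
  assumes "x \<in> X" "y \<in> Y" "a \<in> A" "b \<in> B"
  shows "integrable M (\<lambda>lam. pS lam x y * pO lam x y a b)"
proof (rule Bochner_Integration.integrable_bound[OF integrable_setting[OF assms(1,2)]])
  show "(\<lambda>lam. pS lam x y * pO lam x y a b) \<in> borel_measurable M"
    using hv assms by (intro borel_measurable_times) (auto simp: hv_model_def)
  have "\<bar>pO lam x y a b\<bar> \<le> 1" if "lam \<in> space M" for lam
    using hv that assms joint_distribution_le_1[of A B "pO lam x y" a b]
    by (auto simp: hv_model_def joint_distribution_def)
  then show "AE lam in M. norm (pS lam x y * pO lam x y a b) \<le> norm (pS lam x y)"
    by (intro AE_I2) (auto simp: abs_mult intro!: mult_left_le)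
qed

lemma setting_prob_pos:
  assumes "x \<in> X" "y \<in> Y"
  shows "0 < setting_prob M pS x y"
proof -
  interpret prob_space M using hv by (simp add: hv_model_def)
  have "l \<le> setting_prob M pS x y"
    unfolding setting_prob_def using md assms
    by (intro integral_ge_const integrable_setting AE_I2) (auto simp: measurement_dependent_def)
  with l show ?thesis by simp
qed

text \<open>A nonnegative integrand with zero integral vanishes almost everywhere. As
  \<open>l > 0\<close> keeps the setting weight positive at every hidden variable, the factor that
  vanishes is the outcome probability.\<close>

lemma AE_outcome_zero:
  assumes xy: "x \<in> X" "y \<in> Y" "a \<in> A" "b \<in> B" and zero: "correlation M pS pO x y a b = 0"
  shows "AE lam in M. pO lam x y a b = 0"
proof -
  have pos: "0 < pS lam x y" if "lam \<in> space M" for lam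
    using md l xy that by (force simp: measurement_dependent_def)
  have "0 \<le> pS lam x y * pO lam x y a b" if "lam \<in> space M" for lam
    using hv xy that pos[OF that] by (auto simp: hv_model_def joint_distribution_def)
  moreover have "(\<integral>lam. pS lam x y * pO lam x y a b \<partial>M) = 0"
    using zero setting_prob_pos[OF xy(1,2)] by (simp add: correlation_def)
  ultimately have "AE lam in M. pS lam x y * pO lam x y a b = 0"
    using integral_nonneg_eq_0_iff_AE[OF integrable_setting_outcome[OF xy]] by (simp add: AE_I2)
  then show ?thesis
    using AE_space by eventually_elim (use pos in fastforce)
qed

lemma AE_outcomes_zero:
  assumes xy: "x \<in> X" "y \<in> Y" and R: "R \<subseteq> A \<times> B"
    and zero: "\<And>a b. (a, b) \<in> R \<Longrightarrow> correlation M pS pO x y a b = 0"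
  shows "AE lam in M. \<forall>(a, b)\<in>R. pO lam x y a b = 0"
proof (rule AE_finite_allI)
  interpret prob_space M using hv by (simp add: hv_model_def)
  \<comment> \<open>The model asserts finiteness of the alphabets only at points of
    \<open>space M\<close>, so a point is picked; a probability space has one.\<close>
  obtain lam where "lam \<in> space M" using not_empty by blast
  then have "finite (A \<times> B)" using hv xy by (auto simp: hv_model_def joint_distribution_def)
  then show "finite R" using R finite_subset by blast
next
  fix z assume "z \<in> R"
  then show "AE lam in M. case z of (a, b) \<Rightarrow> pO lam x y a b = 0"
    using AE_outcome_zero[OF xy] zero R by (cases z) auto
qed

text \<open>The correlation averages the outcome probabilities with the weight
  \<open>pS lam x y / setting_prob M pS x y\<close>, which is nonnegative with integral 1. Such an
  average preserves an upper bound valid almost everywhere.\<close>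

lemma sum_correlation_le:
  assumes xy: "x \<in> X" "y \<in> Y" and R: "R \<subseteq> A \<times> B"
    and bound: "AE lam in M. (\<Sum>(a, b)\<in>R. pO lam x y a b) \<le> c"
  shows "(\<Sum>(a, b)\<in>R. correlation M pS pO x y a b) \<le> c"
proof -
  let ?g = "\<lambda>lam (a, b). pS lam x y * pO lam x y a b"
  have int: "integrable M (\<lambda>lam. ?g lam z)" if "z \<in> R" for z
    using integrable_setting_outcome[OF xy] that R by (cases z) auto
  have "(\<Sum>z\<in>R. \<integral>lam. ?g lam z \<partial>M) = (\<integral>lam. (\<Sum>z\<in>R. ?g lam z) \<partial>M)"
    using int by (intro Bochner_Integration.integral_sum[symmetric])
  also have "\<dots> \<le> (\<integral>lam. pS lam x y * c \<partial>M)"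
  proof (rule integral_mono_AE)
    show "AE lam in M. (\<Sum>z\<in>R. ?g lam z) \<le> pS lam x y * c"
      using bound AE_space
    proof eventually_elim
      case (elim lam)
      have "(\<Sum>z\<in>R. ?g lam z) = pS lam x y * (\<Sum>(a, b)\<in>R. pO lam x y a b)"
        by (simp add: sum_distrib_left case_prod_unfold)
      also have "\<dots> \<le> pS lam x y * c"
        using elim md l xy by (intro mult_left_mono) (force simp: measurement_dependent_def)+
      finally show ?case .
    qed
  qed (use int integrable_setting[OF xy] in auto)
  also have "\<dots> = setting_prob M pS x y * c"
    by (simp add: setting_prob_def)
  finally have "(\<Sum>z\<in>R. \<integral>lam. ?g lam z \<partial>M) \<le> setting_prob M pS x y * c" .
  moreover have "(\<Sum>(a, b)\<in>R. correlation M pS pO x y a b) =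
      (\<Sum>z\<in>R. \<integral>lam. ?g lam z \<partial>M) / setting_prob M pS x y"
    by (simp add: correlation_def sum_divide_distrib case_prod_unfold)
  ultimately show ?thesis
    using setting_prob_pos[OF xy] by (simp add: divide_le_eq mult.commute)
qed

end

theorem mainTheorem1:
  fixes N :: nat
    and l epsA epsB :: real
    and M :: "'l measure"
    and pS :: "'l \<Rightarrow> nat \<Rightarrow> nat \<Rightarrow> real"
    and pO :: "'l \<Rightarrow> nat \<Rightarrow> nat \<Rightarrow> (nat \<Rightarrow> nat) \<Rightarrow> (nat \<Rightarrow> nat) \<Rightarrow> real"
  assumes "1 \<le> N"
    and "0 < l"
    and "epsA \<in> {0..1}" and "epsB \<in> {0..1}"
    and "hv_model M {0, 1} {0, 1} (bit_strings N) (bit_strings N) pS pO"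
    and "measurement_dependent l M {0, 1} {0, 1} pS"
    and "parameter_dependent epsA epsB M {0, 1} {0, 1} (bit_strings N) (bit_strings N) pO"
    and "outcome_independent M {0, 1} {0, 1} (bit_strings N) (bit_strings N) pO"
    and "\<forall>a\<in>bit_strings N. \<forall>b\<in>bit_strings N.
           (\<exists>i\<in>{1..N}. (a i, b i) = (0, 1)) \<longrightarrow> correlation M pS pO 0 1 a b = 0"
    and "\<forall>a\<in>bit_strings N. \<forall>b\<in>bit_strings N.
           (\<exists>i\<in>{1..N}. (a i, b i) = (1, 0)) \<longrightarrow> correlation M pS pO 1 0 a b = 0"
    and "\<forall>a\<in>bit_strings N. \<forall>b\<in>bit_strings N.
           (\<exists>i\<in>{1..N}. (a i, b i) = (0, 0)) \<longrightarrow> correlation M pS pO 1 1 a b = 0"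
  shows "(\<Sum>(a, b) \<in> {(a, b). a \<in> bit_strings N \<and> b \<in> bit_strings N \<and>
                              (\<exists>i\<in>{1..N}. (a i, b i) = (0, 0))}.
            correlation M pS pO 0 0 a b)
         \<le> epsA + epsB - epsA * epsB"
proof -
  let ?O = "bit_strings N"
  let ?R = "\<lambda>u v. {(a, b). a \<in> ?O \<and> b \<in> ?O \<and> (\<exists>i\<in>{1..N}. (a i, b i) = (u, v))}"
  note AE_zero = AE_outcomes_zero[OF assms(5,6,2)]
  have "AE lam in M. \<forall>(a, b)\<in>?R 0 1. pO lam 0 1 a b = 0"
    by (rule AE_zero) (use assms(9) in auto)
  moreover have "AE lam in M. \<forall>(a, b)\<in>?R 1 0. pO lam 1 0 a b = 0"
    by (rule AE_zero) (use assms(10) in auto)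
  moreover have "AE lam in M. \<forall>(a, b)\<in>?R 0 0. pO lam 1 1 a b = 0"
    by (rule AE_zero) (use assms(11) in auto)
  \<comment> \<open>Off a single null set all three families of zeros hold at once, so the bound for
    products applies at each remaining hidden variable.\<close>
  ultimately have "AE lam in M. (\<Sum>(a, b)\<in>?R 0 0. pO lam 0 0 a b) \<le> epsA + epsB - epsA * epsB"
    using AE_space
  proof eventually_elim
    case (elim lam)
    let ?P = "marginal_A ?O pO lam" and ?Q = "marginal_B ?O pO lam"
    have prod: "pO lam x y a b = ?P x y a * ?Q x y b"
      if "x \<in> {0,1}" "y \<in> {0,1}" "a \<in> ?O" "b \<in> ?O" for x y a b
      using assms(8) elim(4) that unfolding outcome_independent_def by blast
    have jd: "joint_distribution ?O ?O (pO lam x y)" if "x \<in> {0,1}" "y \<in> {0,1}" for x y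
      using assms(5) elim(4) that unfolding hv_model_def by blast
    have "(\<Sum>(a, b)\<in>?R 0 0. pO lam 0 0 a b) = (\<Sum>(a, b)\<in>?R 0 0. ?P 0 0 a * ?Q 0 0 b)"
      by (rule sum.cong) (auto simp: prod)
    also have "\<dots> \<le> epsA + epsB - epsA * epsB"
    proof (rule hardy_bound_product[where P = ?P and Q = ?Q])
      show "total_variation ?O (?P x y) (?P x y') \<le> epsA"
        if "x \<in> {0,1}" "y \<in> {0,1}" "y' \<in> {0,1}" for x y y'
        using assms(7) elim(4) that unfolding parameter_dependent_def total_variation_def by blast
      show "total_variation ?O (?Q x y) (?Q x' y) \<le> epsB"
        if "x \<in> {0,1}" "x' \<in> {0,1}" "y \<in> {0,1}" for x x' y
        using assms(7) elim(4) that unfolding parameter_dependent_def total_variation_def by blast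
      show "a i = 0 \<or> a i = 1" if "a \<in> ?O \<union> ?O" "i \<in> {1..N}" for a i
        using that by (auto simp: bit_strings_def PiE_iff)
      show "?P 0 1 a * ?Q 0 1 b = 0"
        if "a \<in> ?O" "b \<in> ?O" "i \<in> {1..N}" "a i = 0" "b i = 1" for a b i
        using elim(1) that prod[of 0 1 a b] by fastforce
      show "?P 1 0 a * ?Q 1 0 b = 0"
        if "a \<in> ?O" "b \<in> ?O" "i \<in> {1..N}" "a i = 1" "b i = 0" for a b i
        using elim(2) that prod[of 1 0 a b] by fastforce
      show "?P 1 1 a * ?Q 1 1 b = 0"
        if "a \<in> ?O" "b \<in> ?O" "i \<in> {1..N}" "a i = 0" "b i = 0" for a b i
        using elim(3) that prod[of 1 1 a b] by fastforce
    qed (use assms(3,4) in \<open>auto intro!: prob_vec_marginals jd simp del: One_nat_def\<close>)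
    finally show ?case .
  qed
  then show ?thesis
    by (intro sum_correlation_le[OF assms(5,6,2)]) auto
qed

end
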